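(* Let $\mathcal X$ be a separable infinite-dimensional (real or complex) Banach space, let $T: D(T)\subseteq\mathcal X\to\mathcal X$ be a linear operator, and let $Y$ be a linear subspace of $Y_0=\bigcap_{n=1}^\infty D(T^n)$. If $\overline Y=\mathcal X$ and $(T,Y)$ is relatively hypercyclic, then $T$ is hypercyclic, and moreover $RHC(T,Y)\subseteq HC(T)$.
   Context: $T$ is linear on a linear subspace $D(T)$ of $\mathcal X$ (bounded or unbounded). Powers are defined on their natural domains: $D(T^{n+1})=\{x\in D(T^n): T^nx\in D(T)\}$. For $x\in Y_0$, $\mathrm{orb}(x,T)=\{x,Tx,T^2x,\dots\}$. Closures are taken in $\mathcal X$. $T$ is hypercyclic if there is $x\in Y_0$ with $\overline{\mathrm{orb}(x,T)}=\mathcal X$; such $x$ are the hypercyclic vectors of $T$, and $HC(T)$ is the set of all of them. $(T,Y)$ is relatively hypercyclic if there is a nonzero vector $x\in Y_0$ with $\overline{\mathrm{orb}(x,T)\cap Y}\supseteq Y$; such $x$ are the relatively hypercyclic vectors for $(T,Y)$, and $RHC(T,Y)$ is the set of all of them. *)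

theory Defs
  imports "HOL-Analysis.Analysis"
begin

text \<open>
  The scalar field is a type variable \<open>'k\<close> of class \<open>real_normed_field\<close>, and the scalar
  multiplication on the Banach space is the explicit function \<open>smul\<close>. This is the setting
  ``real or complex'': \<open>real\<close> and \<open>complex\<close> are instances of the class and, since the norm of the
  class is multiplicative, they are up to isomorphism the only ones (Mazur). The underlying real
  Banach space is given by the class \<open>banach\<close>; \<open>smul\<close> has to extend its real scalar
  multiplication and the norm has to be homogeneous for \<open>smul\<close>. For \<open>'k = real\<close> this leaves just
  \<open>smul = scaleR\<close>; for \<open>'k = complex\<close> it describes the complex Banach spaces.
\<close>

locale banach_space_over = vector_space smul
  for smul :: "'k::real_normed_field \<Rightarrow> 'a::banach \<Rightarrow> 'a" +
  assumes smul_of_real: "smul (of_real r) x = r *\<^sub>R x"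
    and norm_smul: "norm (smul c x) = norm c * norm x"

definition infinite_dimensional :: "('k::field \<Rightarrow> 'a::ab_group_add \<Rightarrow> 'a) \<Rightarrow> bool" where
  "infinite_dimensional smul \<longleftrightarrow> (\<nexists>B. finite_dimensional_vector_space smul B)"

text \<open>
  A linear operator with domain \<open>D\<close> is represented by a total function \<open>T\<close> together with \<open>D\<close>;
  the values of \<open>T\<close> outside \<open>D\<close> are arbitrary, and nothing below depends on them, because
  \<open>T ^^ n\<close> is only applied to points of \<open>dom_pow D T n\<close>.
\<close>

definition linear_operator ::
  "('k::field \<Rightarrow> 'a::ab_group_add \<Rightarrow> 'a) \<Rightarrow> 'a set \<Rightarrow> ('a \<Rightarrow> 'a) \<Rightarrow> bool" where
  "linear_operator smul D T \<longleftrightarrow>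
     module.subspace smul D \<and>
     (\<forall>x\<in>D. \<forall>y\<in>D. T (x + y) = T x + T y) \<and>
     (\<forall>c. \<forall>x\<in>D. T (smul c x) = smul c (T x))"

primrec dom_pow :: "'a set \<Rightarrow> ('a \<Rightarrow> 'a) \<Rightarrow> nat \<Rightarrow> 'a set" where
  "dom_pow D T 0 = UNIV"
| "dom_pow D T (Suc n) = {x \<in> dom_pow D T n. (T ^^ n) x \<in> D}"

lemma dom_pow_1: "dom_pow D T 1 = D"
  by simp

definition dom_inf :: "'a set \<Rightarrow> ('a \<Rightarrow> 'a) \<Rightarrow> 'a set" where
  "dom_inf D T = (\<Inter>n\<in>{1..}. dom_pow D T n)"

definition orb :: "'a \<Rightarrow> ('a \<Rightarrow> 'a) \<Rightarrow> 'a set" where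
  "orb x T = {(T ^^ n) x |n. True}"

definition HC :: "'a::topological_space set \<Rightarrow> ('a \<Rightarrow> 'a) \<Rightarrow> 'a set" where
  "HC D T = {x \<in> dom_inf D T. closure (orb x T) = UNIV}"

definition hypercyclic :: "'a::topological_space set \<Rightarrow> ('a \<Rightarrow> 'a) \<Rightarrow> bool" where
  "hypercyclic D T \<longleftrightarrow> (\<exists>x. x \<in> HC D T)"

definition RHC :: "'a::{topological_space,zero} set \<Rightarrow> ('a \<Rightarrow> 'a) \<Rightarrow> 'a set \<Rightarrow> 'a set" where
  "RHC D T Y = {x \<in> dom_inf D T. x \<noteq> 0 \<and> Y \<subseteq> closure (orb x T \<inter> Y)}"

definition relatively_hypercyclic ::
  "'a::{topological_space,zero} set \<Rightarrow> ('a \<Rightarrow> 'a) \<Rightarrow> 'a set \<Rightarrow> bool" where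
  "relatively_hypercyclic D T Y \<longleftrightarrow> (\<exists>x. x \<in> RHC D T Y)"

lemma banach_space_over_real: "banach_space_over (scaleR :: real \<Rightarrow> 'a::banach \<Rightarrow> 'a)"
  by unfold_locales (simp_all add: scaleR_add_right scaleR_add_left)

lemma banach_space_over_complex: "banach_space_over ((*) :: complex \<Rightarrow> complex \<Rightarrow> complex)"
  by unfold_locales (simp_all add: algebra_simps norm_mult scaleR_conv_of_real)

end

theory Submission
  imports Defs
begin

text \<open>If \<open>x\<close> is relatively hypercyclic for \<open>Y\<close>, the closure of its
  orbit is a closed set containing \<open>Y\<close>; since \<open>Y\<close> is dense, that closure
  is the whole space. So the very same vector is hypercyclic, and the inclusion of vector sets
  already carries existence with it.\<close>

lemma RHC_subset_HC:
  assumes "closure Y = UNIV"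
  shows "RHC D T Y \<subseteq> HC D T"
proof
  fix x assume x: "x \<in> RHC D T Y"
  have "Y \<subseteq> closure (orb x T \<inter> Y)"
    using x by (simp add: RHC_def)
  also have "\<dots> \<subseteq> closure (orb x T)"
    by (intro closure_mono) simp
  \<comment> \<open>The right-hand side is closed, so containing \<open>Y\<close> forces it to
    contain \<open>closure Y\<close>.\<close>
  finally have "closure Y \<subseteq> closure (orb x T)"
    by (simp add: closure_minimal)
  with assms x show "x \<in> HC D T"
    by (auto simp: RHC_def HC_def)
qed

theorem proposition2p8:
  fixes smul :: "'k::real_normed_field \<Rightarrow> 'a::banach \<Rightarrow> 'a"
    and D :: "'a set" and T :: "'a \<Rightarrow> 'a" and Y :: "'a set"
  assumes "banach_space_over smul"
    and "separable_space (euclidean :: 'a topology)"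
    and "infinite_dimensional smul"
    and "linear_operator smul D T"
    and "module.subspace smul Y" and "Y \<subseteq> dom_inf D T"
    and "closure Y = UNIV"
    and "relatively_hypercyclic D T Y"
  shows "hypercyclic D T \<and> RHC D T Y \<subseteq> HC D T"
  \<comment> \<open>A witness of relative hypercyclicity is moved along the inclusion into
    \<open>HC D T\<close>.\<close>
  using RHC_subset_HC[OF assms(7), of D T] assms(8)
  by (auto simp: hypercyclic_def relatively_hypercyclic_def)

end
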